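(* Let $V_1$ be a finite-dimensional subspace of a separable infinite-dimensional real Hilbert space $\mathcal{H}$ and let $(e_n)_{n=2}^\infty$ be an orthonormal basis of $V_1^\perp$. For each $m\in\mathbb{N}$ let $V_m=V_1+\mathrm{span}\{e_n:2\leq n\leq m\}$ and let $P_m:\mathcal{H}\to V_m$ be the orthogonal projection. Let $(\psi_j)_{j\in I}\subseteq V_1$ be a frame of $V_1$ with frame bounds $0<A\leq B\leq1$ which does $C$-stable phase retrieval on $V_1$. Let $(\varphi_j)_{j\in J}\subseteq V_1$, with $J$ a finite index set, be a frame of $V_1$ with frame bounds $0<A\leq B\leq1$ for which there exists $c>0$ so that, for all $x\in V_1$, the set $J_c(x)=\{j\in J:|\langle x,\varphi_j\rangle|\geq c\|x\|\}$ satisfies $|J_c(x)|\geq C^{-1}|J|$. Fix $0<\varepsilon<8^{-1}$ and choose a sequence $(\alpha_n)$ decreasing to $0$ such that $\sum_{n=2}^\infty\alpha_n<2^{-2}C^{-1}|J|^{-1/2}\varepsilon$, and a sequence $(\beta_n)$ decreasing to $0$ such that $\beta_n<2^{-6}c^2\alpha_n$ for all $n\geq2$. Define the subset $$\mathcal{B}=\{f\in\mathcal{H}:\ \|f-P_mf\|\leq\beta_{m+1}\|f\|\ \text{ for every } m\in\mathbb{N}\}$$ and consider the frame $\Phi:=(\psi_j)_{j\in I}\cup(\varphi_{j,n})_{j\in J,\,n\geq2}$ of $\mathcal{H}$, where $\varphi_{j,n}:=\alpha_n\varphi_j+|J|^{-1/2}e_n$ for all $j\in J$ and $n\geq2$.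 Then $\Phi$ has lower frame bound $\left(1-\sqrt{\varepsilon/A}\right)^2A$ and upper frame bound $(1+\sqrt{\varepsilon})^2$. Furthermore, for all $f,g\in\mathcal{B}$ we have $$\inf_{|\alpha|=1}\|f-\alpha g\|^2\leq(1-\varepsilon)^{-1}C^2\|\mathcal{A}_\Phi(f)-\mathcal{A}_\Phi(g)\|^2.$$
   Context: A family $(\phi_k)_{k\in K}$ in a Hilbert space $H$ is a frame of $H$ with lower frame bound $A>0$ and upper frame bound $B$ if $A\|f\|^2\leq\sum_{k\in K}|\langle f,\phi_k\rangle|^2\leq B\|f\|^2$ for all $f\in H$. For a frame $\Phi=(\phi_k)_{k\in K}$, $\mathcal{A}_\Phi(f)=(|\langle f,\phi_k\rangle|)_{k\in K}\in\ell_2(K)$, and $\|\mathcal{A}_\Phi(f)-\mathcal{A}_\Phi(g)\|$ is the $\ell_2(K)$ norm. For a constant $C\geq1$, the frame $\Phi$ of $H$ does $C$-stable phase retrieval on $H$ if $\inf_{|\alpha|=1}\|f-\alpha g\|\leq C\|\mathcal{A}_\Phi(f)-\mathcal{A}_\Phi(g)\|$ for all $f,g\in H$. Here scalars are real, so the infimum is over $\alpha=\pm1$. $|J|$ denotes the cardinality of $J$.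
   Formalization: The stated lower frame bound is proved only for ε < A (it can fail for ε ≥ A; that Φ is a frame with the stated upper bound is proved for all ε), and the phase retrieval inequality only for V_1 ≠ {0} (it can fail for V_1 = {0}, where c is unconstrained). *)

theory Defs
  imports "HOL-Analysis.Analysis"
begin

definition finite_dimensional :: "'a::real_vector set \<Rightarrow> bool"
  where "finite_dimensional W \<longleftrightarrow> (\<exists>F. finite F \<and> W = span F)"

definition orthonormal_basis :: "'n set \<Rightarrow> ('n \<Rightarrow> 'a::real_inner) \<Rightarrow> 'a set \<Rightarrow> bool"
  where "orthonormal_basis N e W \<longleftrightarrow>
    (\<forall>m\<in>N. \<forall>n\<in>N. e m \<bullet> e n = (if m = n then 1 else 0)) \<and> closure (span (e ` N)) = W"

(* Meaningful whenever each vector has a (then unique) orthogonal projection onto W,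
   in particular for finite-dimensional subspaces W. *)
definition orth_proj :: "'a::real_inner set \<Rightarrow> 'a \<Rightarrow> 'a"
  where "orth_proj W f = (THE p. p \<in> W \<and> f - p \<in> orthogonal_comp W)"

(* The Hilbert space in which the frame lives is a closed subspace S of the ambient type
   (S = UNIV for the whole space). The summability clause is part of the upper bound, because
   a divergent infsum is 0 by convention. *)
definition frame_with_bounds ::
    "'a::real_inner set \<Rightarrow> 'k set \<Rightarrow> ('k \<Rightarrow> 'a) \<Rightarrow> real \<Rightarrow> real \<Rightarrow> bool"
  where "frame_with_bounds S K \<phi> A B \<longleftrightarrow>
    0 < A \<and> (\<forall>k\<in>K. \<phi> k \<in> S) \<and>
    (\<forall>f\<in>S. (\<lambda>k. \<bar>f \<bullet> \<phi> k\<bar>\<^sup>2) summable_on K \<and>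
       A * (norm f)\<^sup>2 \<le> (\<Sum>\<^sub>\<infinity>k\<in>K. \<bar>f \<bullet> \<phi> k\<bar>\<^sup>2) \<and>
       (\<Sum>\<^sub>\<infinity>k\<in>K. \<bar>f \<bullet> \<phi> k\<bar>\<^sup>2) \<le> B * (norm f)\<^sup>2)"

definition measurements :: "('k \<Rightarrow> 'a::real_inner) \<Rightarrow> 'a \<Rightarrow> 'k \<Rightarrow> real"
  where "measurements \<phi> f = (\<lambda>k. \<bar>f \<bullet> \<phi> k\<bar>)"

(* Used only on differences of measurements of a frame, which are square summable. *)
definition l2_norm :: "'k set \<Rightarrow> ('k \<Rightarrow> real) \<Rightarrow> real"
  where "l2_norm K a = sqrt (\<Sum>\<^sub>\<infinity>k\<in>K. (a k)\<^sup>2)"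

definition stable_phase_retrieval ::
    "real \<Rightarrow> 'a::real_inner set \<Rightarrow> 'k set \<Rightarrow> ('k \<Rightarrow> 'a) \<Rightarrow> bool"
  where "stable_phase_retrieval C S K \<phi> \<longleftrightarrow>
    C \<ge> 1 \<and>
    (\<forall>f\<in>S. \<forall>g\<in>S. (INF \<sigma>\<in>{\<sigma>::real. \<bar>\<sigma>\<bar> = 1}. norm (f - \<sigma> *\<^sub>R g))
       \<le> C * l2_norm K (\<lambda>k. measurements \<phi> f k - measurements \<phi> g k))"

definition extended_space :: "'a::real_vector set \<Rightarrow> (nat \<Rightarrow> 'a) \<Rightarrow> nat \<Rightarrow> 'a set"
  where "extended_space V1 e m = {v + w |v w. v \<in> V1 \<and> w \<in> span (e ` {2..m})}"

(* m ranges over the positive integers: e and \<beta> are only specified at indices at least 2. *)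
definition projection_decay_set :: "'a::real_inner set \<Rightarrow> (nat \<Rightarrow> 'a) \<Rightarrow> (nat \<Rightarrow> real) \<Rightarrow> 'a set"
  where "projection_decay_set V1 e \<beta> =
    {f. \<forall>m\<ge>1. norm (f - orth_proj (extended_space V1 e m) f) \<le> \<beta> (m + 1) * norm f}"

(* The union of the two families is a disjoint union of indexed families, so its index set is
   the sum I <+> (J \<times> {2..}). *)
definition combined_family ::
    "('i \<Rightarrow> 'a::real_inner) \<Rightarrow> 'j set \<Rightarrow> ('j \<Rightarrow> 'a) \<Rightarrow> (nat \<Rightarrow> 'a) \<Rightarrow> (nat \<Rightarrow> real)
      \<Rightarrow> 'i + 'j \<times> nat \<Rightarrow> 'a"
  where "combined_family \<psi> J \<phi> e \<alpha> =
    case_sum \<psi> (\<lambda>(j, n). \<alpha> n *\<^sub>R \<phi> j + (1 / sqrt (real (card J))) *\<^sub>R e n)"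

end

theory Submission
  imports Defs
begin

text \<open>Split \<open>f = v + w\<close> with \<open>v\<close> in \<open>V1\<close> and \<open>w\<close> orthogonal to it. The measurements of \<open>f\<close> are those of
  \<open>v\<close> under \<open>\<psi>\<close> and the coefficients of \<open>w\<close>, each repeated \<open>card J\<close> times with weight
  \<open>1 / sqrt (card J)\<close>, up to a perturbation of square sum at most \<open>\<epsilon> (norm v)\<^sup>2\<close>; this gives the
  frame bounds. For stability choose the sign of \<open>g = v' + w'\<close> so that \<open>v - v'\<close> is the shorter of
  \<open>v - v'\<close> and \<open>v + v'\<close>; then \<open>\<psi>\<close> controls \<open>v - v'\<close>. At least \<open>card J / C\<close> of the \<open>\<phi> j\<close>
  have a large inner product with \<open>v + v'\<close>, and for those the decay of \<open>f\<close> and \<open>g\<close> makes the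
  modulus lose nothing of the coefficients of \<open>w - w'\<close>.\<close>

section \<open>Orthogonal projections and Parseval's identity\<close>

lemma orth_decomposition_exists:
  fixes W :: "'a::real_inner set"
  assumes "finite_dimensional W"
  obtains p where "p \<in> W" "f - p \<in> orthogonal_comp W"
proof -
  obtain F where F: "finite F" "W = span F"
    using assms unfolding finite_dimensional_def by blast
  have "\<forall>f. \<exists>p\<in>span F. \<forall>y\<in>F. y \<bullet> (f - p) = 0"
    using F(1)
  proof (induction F)
    case empty
    then show ?case by simp
  next
    case (insert a F)
    obtain p where p: "p \<in> span F" "\<And>y. y \<in> F \<Longrightarrow> y \<bullet> (a - p) = 0"
      using insert.IH by blast
    \<comment> \<open>Gram-Schmidt step: \<open>b\<close> is the part of the new generator
      \<open>a\<close> orthogonal to \<open>span F\<close>, so moving along \<open>b\<close> does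
      not disturb orthogonality to \<open>F\<close>.\<close>
    define b where "b = a - p"
    have bspan: "b \<in> span (insert a F)"
      unfolding b_def by (meson p(1) span_base span_diff span_mono subset_insertI subsetD insertI1)
    have orth_span: "z \<bullet> u = 0" if "z \<in> span F" "\<And>y. y \<in> F \<Longrightarrow> y \<bullet> u = 0" for z u
      using that by (induction rule: span_induct_alt) (auto simp: inner_left_distrib)
    show ?case
    proof
      fix f
      obtain q where q: "q \<in> span F" "\<And>y. y \<in> F \<Longrightarrow> y \<bullet> (f - q) = 0"
        using insert.IH by blast
      \<comment> \<open>If \<open>b = 0\<close>, the quotient is 0 by convention and
        \<open>s = q\<close> is already the projection, since \<open>a\<close> then lies in
        \<open>span F\<close>.\<close>
      define s where "s = q + ((b \<bullet> (f - q)) / (b \<bullet> b)) *\<^sub>R b"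
      have "s \<in> span (insert a F)"
        unfolding s_def
        by (meson q(1) bspan span_add span_scale span_mono subset_insertI subsetD)
      moreover have F0: "y \<bullet> (f - s) = 0" if "y \<in> F" for y
        using q(2)[OF that] p(2)[OF that] by (simp add: s_def b_def inner_diff_right inner_add_right)
      moreover have "b \<bullet> (f - s) = 0"
        by (cases "b = 0") (simp_all add: s_def inner_diff_right inner_add_right)
      then have "a \<bullet> (f - s) = 0"
        using orth_span[OF p(1) F0] by (simp add: b_def inner_diff_left)
      ultimately show "\<exists>p\<in>span (insert a F). \<forall>y\<in>insert a F. y \<bullet> (f - p) = 0"
        by blast
    qed
  qed
  then obtain p where p: "p \<in> span F" "\<And>y. y \<in> F \<Longrightarrow> y \<bullet> (f - p) = 0"
    by blast
  have "z \<bullet> (f - p) = 0" if "z \<in> span F" for z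
    using that by (induction rule: span_induct_alt) (auto simp: inner_left_distrib p(2))
  then show ?thesis
    using that p(1) F(2) by (auto simp: orthogonal_comp_def orthogonal_def)
qed

text \<open>The difference of two candidates lies both in \<open>W\<close> and in its orthogonal
  complement, hence is orthogonal to itself. This is the way to evaluate the definite description
  behind \<open>orth_proj\<close>.\<close>

lemma orth_proj_eq:
  assumes "subspace W" "p \<in> W" "f - p \<in> orthogonal_comp W"
  shows "orth_proj W f = p"
  unfolding orth_proj_def
proof (rule the_equality)
  fix q assume q: "q \<in> W \<and> f - q \<in> orthogonal_comp W"
  then have "q - p \<in> W" and "(f - p) - (f - q) \<in> orthogonal_comp W"
    using assms subspace_diff subspace_orthogonal_comp by blast+
  then have "(q - p) \<bullet> (q - p) = 0"
    by (auto simp: orthogonal_comp_def orthogonal_def)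
  then show "q = p" by simp
qed (use assms in simp)

text \<open>Everything follows from one expansion of the distance from \<open>w\<close> to a finite
  combination with arbitrary coefficients \<open>x\<close>. Taking the coefficients of
  \<open>w\<close> gives Bessel's inequality; taking those of an element of the span close to
  \<open>w\<close> gives the reverse inequality up to \<delta>.\<close>

lemma Parseval_has_sum:
  fixes e :: "'n \<Rightarrow> 'a::real_inner"
  assumes on: "\<And>m n. m \<in> N \<Longrightarrow> n \<in> N \<Longrightarrow> e m \<bullet> e n = (if m = n then 1 else 0)"
    and w: "w \<in> closure (span (e ` N))"
  shows "((\<lambda>n. (w \<bullet> e n)\<^sup>2) has_sum (norm w)\<^sup>2) N"
proof -
  have expand: "(norm (w - (\<Sum>n\<in>F. x n *\<^sub>R e n)))\<^sup>2
      = (norm w)\<^sup>2 - (\<Sum>n\<in>F. (w \<bullet> e n)\<^sup>2) + (\<Sum>n\<in>F. (w \<bullet> e n - x n)\<^sup>2)"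
    if F: "finite F" "F \<subseteq> N" for F and x :: "'n \<Rightarrow> real"
  proof -
    have eq: "(\<Sum>m\<in>F. x n * x m * (e n \<bullet> e m)) = (x n)\<^sup>2" if "n \<in> F" for n
    proof -
      have "(\<Sum>m\<in>F. x n * x m * (e n \<bullet> e m)) = (\<Sum>m\<in>F. if m = n then (x n)\<^sup>2 else 0)"
        using on F that by (intro sum.cong) (auto simp: power2_eq_square subset_iff)
      then show ?thesis using F that by simp
    qed
    have "(\<Sum>n\<in>F. x n *\<^sub>R e n) \<bullet> (\<Sum>n\<in>F. x n *\<^sub>R e n)
        = (\<Sum>n\<in>F. \<Sum>m\<in>F. x n * x m * (e n \<bullet> e m))"
      by (simp add: inner_sum_left inner_sum_right sum_distrib_left mult_ac inner_commute)
    also have "\<dots> = (\<Sum>n\<in>F. (x n)\<^sup>2)" using eq by simp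
    finally have 1: "(\<Sum>n\<in>F. x n *\<^sub>R e n) \<bullet> (\<Sum>n\<in>F. x n *\<^sub>R e n) = (\<Sum>n\<in>F. (x n)\<^sup>2)" .
    have "(norm (w - (\<Sum>n\<in>F. x n *\<^sub>R e n)))\<^sup>2
        = w \<bullet> w - 2 * (\<Sum>n\<in>F. x n * (w \<bullet> e n)) + (\<Sum>n\<in>F. (x n)\<^sup>2)"
      unfolding 1[symmetric] power2_norm_eq_inner
      by (simp add: inner_diff_left inner_diff_right inner_commute inner_sum_right)
    also have "\<dots> = (norm w)\<^sup>2 + (\<Sum>n\<in>F. (w \<bullet> e n - x n)\<^sup>2 - (w \<bullet> e n)\<^sup>2)"
      by (simp add: power2_norm_eq_inner power2_diff sum.distrib sum_subtractf
          sum_distrib_left mult_ac)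
    finally show ?thesis by (simp add: sum_subtractf)
  qed
  have bessel: "(\<Sum>n\<in>F. (w \<bullet> e n)\<^sup>2) \<le> (norm w)\<^sup>2" if "finite F" "F \<subseteq> N" for F
    using expand[OF that, of "\<lambda>n. w \<bullet> e n"] zero_le_power2[of "norm (w - (\<Sum>n\<in>F. (w \<bullet> e n) *\<^sub>R e n))"]
    by simp
  have summ: "(\<lambda>n. (w \<bullet> e n)\<^sup>2) summable_on N"
    by (rule nonneg_bdd_above_summable_on) (auto intro!: bdd_aboveI2[where M = "(norm w)\<^sup>2"] bessel)
  have "(norm w)\<^sup>2 \<le> infsum (\<lambda>n. (w \<bullet> e n)\<^sup>2) N + \<delta>" if "\<delta> > 0" for \<delta> :: real
  proof -
    obtain y where y: "y \<in> span (e ` N)" "dist y w < sqrt \<delta>"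
      using w real_sqrt_gt_zero[OF \<open>\<delta> > 0\<close>] unfolding closure_approachable by blast
    obtain T r where T: "finite T" "T \<subseteq> e ` N" "y = (\<Sum>a\<in>T. r a *\<^sub>R a)"
      using y(1) unfolding span_explicit by blast
    \<comment> \<open>The finite set \<open>T\<close> of vectors is re-indexed by a set on which
      \<open>e\<close> is injective, so that \<open>y\<close> becomes a combination to which
      \<open>expand\<close> applies.\<close>
    obtain F where F: "F \<subseteq> N" "finite F" "inj_on e F" "T = e ` F"
      using T(1,2) by (metis finite_image_iff subset_image_inj)
    have yF: "y = (\<Sum>n\<in>F. r (e n) *\<^sub>R e n)"
      using T(3) F by (simp add: sum.reindex)
    have "(norm (w - y))\<^sup>2 \<le> \<delta>"
      using y(2) that by (metis dist_commute dist_norm less_imp_le norm_ge_zero power_mono real_sqrt_pow2)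
    moreover have "0 \<le> (\<Sum>n\<in>F. (w \<bullet> e n - r (e n))\<^sup>2)" by (simp add: sum_nonneg)
    moreover have "(\<Sum>n\<in>F. (w \<bullet> e n)\<^sup>2) \<le> infsum (\<lambda>n. (w \<bullet> e n)\<^sup>2) N"
      by (rule finite_sum_le_infsum) (use summ F in auto)
    ultimately show ?thesis
      using expand[of F "\<lambda>n. r (e n)"] F yF by auto
  qed
  then have "(norm w)\<^sup>2 \<le> infsum (\<lambda>n. (w \<bullet> e n)\<^sup>2) N" by (rule field_le_epsilon)
  moreover have "infsum (\<lambda>n. (w \<bullet> e n)\<^sup>2) N \<le> (norm w)\<^sup>2"
    by (rule infsum_le_finite_sums) (use summ bessel in auto)
  ultimately show ?thesis using summ by (simp add: has_sum_iff)
qed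

section \<open>Unordered sums over sum and product index sets, and weighted square
  inequalities\<close>

lemma has_sum_finite_Times:
  fixes h :: "'j \<times> 'n \<Rightarrow> 'b::topological_comm_monoid_add"
  assumes "finite J" "\<And>j. j \<in> J \<Longrightarrow> ((\<lambda>n. h (j, n)) has_sum t j) N"
  shows "(h has_sum sum t J) (J \<times> N)"
  using assms
proof (induction J)
  case (insert j J)
  have "(h has_sum t j) (Pair j ` N)"
    using insert.prems[of j] by (simp add: has_sum_reindex inj_on_def o_def)
  moreover have "(h has_sum sum t J) (J \<times> N)"
    using insert by simp
  ultimately have "(h has_sum (t j + sum t J)) (Pair j ` N \<union> J \<times> N)"
    by (rule has_sum_Un_disjoint) (use insert.hyps in auto)
  moreover have "Pair j ` N \<union> J \<times> N = insert j J \<times> N" by auto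
  ultimately show ?case using insert.hyps by simp
qed simp

lemma has_sum_finite_swap:
  fixes h :: "'j \<Rightarrow> 'n \<Rightarrow> 'b::topological_comm_monoid_add"
  assumes "finite J" "\<And>j. j \<in> J \<Longrightarrow> (h j has_sum t j) N"
  shows "((\<lambda>n. \<Sum>j\<in>J. h j n) has_sum sum t J) N"
  using assms by (induction J) (auto intro!: has_sum_add)

lemma has_sum_Plus_Times:
  fixes h :: "'i + 'j \<times> 'n \<Rightarrow> 'b::topological_comm_monoid_add"
  assumes "((\<lambda>i. h (Inl i)) has_sum s) I"
    and "finite J" "\<And>j. j \<in> J \<Longrightarrow> ((\<lambda>n. h (Inr (j, n))) has_sum t j) N"
  shows "(h has_sum (s + sum t J)) (I <+> (J \<times> N))"
  unfolding Plus_def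
proof (rule has_sum_Un_disjoint)
  show "(h has_sum s) (Inl ` I)"
    using assms(1) by (simp add: has_sum_reindex o_def)
  show "(h has_sum sum t J) (Inr ` (J \<times> N))"
    using has_sum_finite_Times[OF assms(2), where h = "\<lambda>x. h (Inr x)" and t = t and N = N] assms(3)
    by (simp add: has_sum_reindex o_def)
qed auto

text \<open>The defect is the square \<open>(t * z - u)\<^sup>2 / t\<close>. In the applications
  \<open>z\<close> is a weighted coefficient, \<open>u\<close> its perturbation, and the weight
  \<open>t\<close> stays free so that it can be tuned to each bound.\<close>

lemma square_add_upper:
  fixes u z t :: real
  assumes "t > 0"
  shows "(u + z)\<^sup>2 \<le> (1 + t) * z\<^sup>2 + (1 + 1 / t) * u\<^sup>2"
proof -
  have "(1 + t) * z\<^sup>2 + (1 + 1 / t) * u\<^sup>2 - (u + z)\<^sup>2 = (t * z - u)\<^sup>2 / t"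
    using assms by (simp add: field_simps power2_eq_square)
  moreover have "\<dots> \<ge> 0" using assms by simp
  ultimately show ?thesis by linarith
qed

text \<open>Here the defect is \<open>(t * z + u)\<^sup>2 / t\<close>: a fraction
  \<open>1 - t\<close> of the main term survives, at a price in \<open>u\<close> that grows as
  \<open>t\<close> shrinks.\<close>

lemma square_add_lower:
  fixes u z t :: real
  assumes "t > 0"
  shows "(1 - t) * z\<^sup>2 - (1 / t - 1) * u\<^sup>2 \<le> (u + z)\<^sup>2"
proof -
  have "(u + z)\<^sup>2 - ((1 - t) * z\<^sup>2 - (1 / t - 1) * u\<^sup>2) = (t * z + u)\<^sup>2 / t"
    using assms by (simp add: field_simps power2_eq_square)
  moreover have "\<dots> \<ge> 0" using assms by simp
  ultimately show ?thesis by linarith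
qed

section \<open>Measurements of the combined family\<close>

lemma inner_combined_family:
  "f \<bullet> combined_family \<psi> J \<phi> e \<alpha> (Inl i) = f \<bullet> \<psi> i"
  "f \<bullet> combined_family \<psi> J \<phi> e \<alpha> (Inr (j, n))
    = \<alpha> n * (f \<bullet> \<phi> j) + (1 / sqrt (real (card J))) * (f \<bullet> e n)"
  by (simp_all add: combined_family_def inner_add_right)

text \<open>\<open>M\<close> collects the measurements of the vectors indexed by
  \<open>J \<times> {2..}\<close>. The two square inequalities are applied to every pair
  \<open>(j, n)\<close> and summed; the \<open>card J\<close> copies of each coefficient, with
  squared weight \<open>1 / card J\<close>, recombine to \<open>W\<close>. The weight
  \<open>t\<close> is left free because the upper and the lower frame bounds need different
  choices.\<close>

lemma combined_family_has_sum:
  fixes f :: "'a::real_inner"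
  assumes J: "finite J" "J \<noteq> {}"
    and \<psi>: "((\<lambda>i. \<bar>f \<bullet> \<psi> i\<bar>\<^sup>2) has_sum S) I"
    and \<alpha>: "((\<lambda>n. (\<alpha> n)\<^sup>2) has_sum s) {2..}"
    and e: "((\<lambda>n. (f \<bullet> e n)\<^sup>2) has_sum W) {2..}"
  obtains M where "((\<lambda>k. \<bar>f \<bullet> combined_family \<psi> J \<phi> e \<alpha> k\<bar>\<^sup>2) has_sum (S + M)) (I <+> (J \<times> {2..}))"
    "\<And>t. t > 0 \<Longrightarrow> M \<le> (1 + t) * W + (1 + 1 / t) * (s * (\<Sum>j\<in>J. \<bar>f \<bullet> \<phi> j\<bar>\<^sup>2))"
    "\<And>t. t > 0 \<Longrightarrow> (1 - t) * W - (1 / t - 1) * (s * (\<Sum>j\<in>J. \<bar>f \<bullet> \<phi> j\<bar>\<^sup>2)) \<le> M"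
proof -
  define r where "r = 1 / sqrt (real (card J))"
  have cJ: "real (card J) > 0" using J by (simp add: card_gt_0_iff)
  then have r2: "r\<^sup>2 = 1 / real (card J)" by (simp add: r_def power_divide)
  define h where "h j n = (\<alpha> n * (f \<bullet> \<phi> j) + r * (f \<bullet> e n))\<^sup>2" for j n
  define m where "m j = infsum (h j) {2..}" for j
  \<comment> \<open>The free factor \<open>x\<close> here and in \<open>u\<close> lets the same two
    series serve both bounds; in the lower one the perturbation carries the factor
    \<open>- (1 / t - 1)\<close>.\<close>
  have z: "((\<lambda>n. x * (r * (f \<bullet> e n))\<^sup>2) has_sum (x * r\<^sup>2 * W)) {2..}" for x
    using has_sum_cmult_right[OF e, of "x * r\<^sup>2"] by (simp add: power_mult_distrib mult.assoc)
  have u: "((\<lambda>n. x * (\<alpha> n * (f \<bullet> \<phi> j))\<^sup>2) has_sum (x * (s * \<bar>f \<bullet> \<phi> j\<bar>\<^sup>2))) {2..}" for x j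
    using has_sum_cmult_right[OF \<alpha>, of "x * (f \<bullet> \<phi> j)\<^sup>2"]
    by (simp add: power_mult_distrib mult_ac)
  have hs: "(h j has_sum m j) {2..}" for j
  proof -
    \<comment> \<open>Convergence comes first, from the majorant given by weight 1.\<close>
    have "h j summable_on {2..}"
    proof (rule summable_on_comparison_test)
      show "(\<lambda>n. 2 * (r * (f \<bullet> e n))\<^sup>2 + 2 * (\<alpha> n * (f \<bullet> \<phi> j))\<^sup>2) summable_on {2..}"
        by (rule has_sum_imp_summable[OF has_sum_add[OF z u]])
      show "h j n \<le> 2 * (r * (f \<bullet> e n))\<^sup>2 + 2 * (\<alpha> n * (f \<bullet> \<phi> j))\<^sup>2" for n
        using square_add_upper[of 1] by (simp add: h_def)
    qed (simp add: h_def)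
    then show ?thesis by (simp add: m_def)
  qed
  show ?thesis
  proof (rule that[of "sum m J"])
    show "((\<lambda>k. \<bar>f \<bullet> combined_family \<psi> J \<phi> e \<alpha> k\<bar>\<^sup>2) has_sum (S + sum m J)) (I <+> (J \<times> {2..}))"
      by (rule has_sum_Plus_Times[OF _ J(1)])
        (use \<psi> hs in \<open>simp_all add: inner_combined_family r_def h_def [abs_def]\<close>)
  next
    fix t :: real assume t: "t > 0"
    have "m j \<le> (1 + t) * r\<^sup>2 * W + (1 + 1 / t) * (s * \<bar>f \<bullet> \<phi> j\<bar>\<^sup>2)" for j
      by (rule has_sum_mono[OF hs has_sum_add[OF z u]]) (use square_add_upper[OF t] in \<open>simp add: h_def\<close>)
    then have "sum m J \<le> (\<Sum>j\<in>J. (1 + t) * r\<^sup>2 * W + (1 + 1 / t) * (s * \<bar>f \<bullet> \<phi> j\<bar>\<^sup>2))"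
      by (rule sum_mono)
    also have "\<dots> = (1 + t) * W + (1 + 1 / t) * (s * (\<Sum>j\<in>J. \<bar>f \<bullet> \<phi> j\<bar>\<^sup>2))"
      using cJ by (simp add: sum.distrib r2 sum_distrib_left)
    finally show "sum m J \<le> (1 + t) * W + (1 + 1 / t) * (s * (\<Sum>j\<in>J. \<bar>f \<bullet> \<phi> j\<bar>\<^sup>2))" .
    have "(1 - t) * r\<^sup>2 * W + (- (1 / t - 1)) * (s * \<bar>f \<bullet> \<phi> j\<bar>\<^sup>2) \<le> m j" for j
      by (rule has_sum_mono[OF has_sum_add[OF z u] hs]) (use square_add_lower[OF t] in \<open>simp add: h_def del: minus_diff_eq\<close>)
    then have "(\<Sum>j\<in>J. (1 - t) * r\<^sup>2 * W + (- (1 / t - 1)) * (s * \<bar>f \<bullet> \<phi> j\<bar>\<^sup>2)) \<le> sum m J"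
      by (rule sum_mono)
    moreover have "(\<Sum>j\<in>J. (1 - t) * r\<^sup>2 * W + (- (1 / t - 1)) * (s * \<bar>f \<bullet> \<phi> j\<bar>\<^sup>2))
        = (1 - t) * W - (1 / t - 1) * (s * (\<Sum>j\<in>J. \<bar>f \<bullet> \<phi> j\<bar>\<^sup>2))"
      using cJ by (simp add: sum_subtractf r2 sum_distrib_left[symmetric] del: minus_diff_eq)
    ultimately show "(1 - t) * W - (1 / t - 1) * (s * (\<Sum>j\<in>J. \<bar>f \<bullet> \<phi> j\<bar>\<^sup>2)) \<le> sum m J" by simp
  qed
qed

text \<open>If the signs of the two measurements disagree, the difference of the moduli is
  \<open>\<bar>p + q\<bar>\<close>, which the contribution of \<open>a + b\<close> alone makes larger than \<open>r \<bar>w - w'\<bar>\<close>.\<close>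
lemma modulus_gap_lower:
  fixes a b w w' r x y t :: real
  assumes t: "0 < t" "t \<le> 1"
    and ab: "y \<le> x * \<bar>a + b\<bar>" and x: "0 \<le> x" and r: "0 \<le> r"
    and sum: "r * \<bar>w + w'\<bar> \<le> y / 2" and diff: "r * \<bar>w - w'\<bar> \<le> y / 2"
  shows "(1 - t) * (r\<^sup>2 * (w - w')\<^sup>2) - (1 / t - 1) * (x\<^sup>2 * (a - b)\<^sup>2)
    \<le> (\<bar>x * a + r * w\<bar> - \<bar>x * b + r * w'\<bar>)\<^sup>2"
proof -
  let ?p = "x * a + r * w" and ?q = "x * b + r * w'"
  consider "\<bar>\<bar>?p\<bar> - \<bar>?q\<bar>\<bar> = \<bar>?p - ?q\<bar>" | "\<bar>\<bar>?p\<bar> - \<bar>?q\<bar>\<bar> = \<bar>?p + ?q\<bar>" by linarith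
  then show ?thesis
  proof cases
    case 1
    then have "(\<bar>?p\<bar> - \<bar>?q\<bar>)\<^sup>2 = (x * (a - b) + r * (w - w'))\<^sup>2"
      by (metis (no_types, opaque_lifting) power2_abs add_diff_add right_diff_distrib)
    then show ?thesis
      using square_add_lower[OF t(1), of "r * (w - w')" "x * (a - b)"]
      by (simp add: power_mult_distrib)
  next
    case 2
    have "x * \<bar>a + b\<bar> = \<bar>x * (a + b)\<bar>" "r * \<bar>w + w'\<bar> = \<bar>r * (w + w')\<bar>"
      using x r by (simp_all add: abs_mult)
    moreover have "?p + ?q = x * (a + b) + r * (w + w')" by (simp add: algebra_simps)
    ultimately have "r * \<bar>w - w'\<bar> \<le> \<bar>?p + ?q\<bar>" using ab sum diff by linarith
    then have "(r * \<bar>w - w'\<bar>)\<^sup>2 \<le> \<bar>?p + ?q\<bar>\<^sup>2" using r by (intro power_mono) auto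
    then have "r\<^sup>2 * (w - w')\<^sup>2 \<le> (\<bar>?p\<bar> - \<bar>?q\<bar>)\<^sup>2"
      using 2 by (metis power2_abs power_mult_distrib)
    moreover have "(1 - t) * (r\<^sup>2 * (w - w')\<^sup>2) \<le> 1 * (r\<^sup>2 * (w - w')\<^sup>2)"
      using t by (intro mult_right_mono) auto
    moreover have "0 \<le> (1 / t - 1) * (x\<^sup>2 * (a - b)\<^sup>2)" using t by simp
    ultimately show ?thesis by linarith
  qed
qed

text \<open>\<open>modulus_gap_lower\<close> applies to each \<open>j\<close> in \<open>L\<close>.
  These are at least \<open>card J / C\<close> indices, each with squared weight
  \<open>1 / card J\<close>, so together they retain a fraction \<open>1 / C\<close> of
  \<open>W\<close>. For the other \<open>j\<close> only nonnegativity of the squared gap is used,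
  and \<psi> contributes \<open>S\<close> unchanged.\<close>

lemma combined_family_gap:
  fixes f g :: "'a::real_inner"
  assumes J: "finite J" "J \<noteq> {}" and L: "L \<subseteq> J" "real (card J) \<le> C * real (card L)" and C: "C > 0"
    and t: "0 < t" "t \<le> 1"
    and low: "\<And>j. j \<in> L \<Longrightarrow> c * X \<le> \<bar>(f + g) \<bullet> \<phi> j\<bar>"
    and \<alpha>0: "\<And>n. n \<ge> 2 \<Longrightarrow> 0 \<le> \<alpha> n"
    and high: "\<And>n. n \<ge> 2 \<Longrightarrow> \<bar>f \<bullet> e n\<bar> + \<bar>g \<bullet> e n\<bar> \<le> \<alpha> n * (c * X) / 2"
    and \<alpha>: "((\<lambda>n. (\<alpha> n)\<^sup>2) has_sum s) {2..}"
    and e: "((\<lambda>n. ((f - g) \<bullet> e n)\<^sup>2) has_sum W) {2..}"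
    and \<psi>: "((\<lambda>i. (measurements \<psi> f i - measurements \<psi> g i)\<^sup>2) has_sum S) I"
    and \<Phi>: "\<Phi> = combined_family \<psi> J \<phi> e \<alpha>"
    and summ: "(\<lambda>k. \<bar>(f - g) \<bullet> \<Phi> k\<bar>\<^sup>2) summable_on (I <+> (J \<times> {2..}))"
  shows "S + (1 - t) / C * W - (1 / t - 1) * (s * (\<Sum>j\<in>J. \<bar>(f - g) \<bullet> \<phi> j\<bar>\<^sup>2))
    \<le> (l2_norm (I <+> (J \<times> {2..})) (\<lambda>k. measurements \<Phi> f k - measurements \<Phi> g k))\<^sup>2"
proof -
  define r where "r = 1 / sqrt (real (card J))"
  have cJ: "real (card J) \<ge> 1" using J by (simp add: Suc_leI card_gt_0_iff)
  then have r: "r\<^sup>2 = 1 / real (card J)" "0 \<le> r" "r \<le> 1"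
    by (simp_all add: r_def power_divide)
  define Q where "Q = (\<Sum>j\<in>J. \<bar>(f - g) \<bullet> \<phi> j\<bar>\<^sup>2)"
  define h where "h k = (measurements \<Phi> f k - measurements \<Phi> g k)\<^sup>2" for k
  \<comment> \<open>By the reverse triangle inequality the gaps are dominated by the measurements of
    \<open>f - g\<close>, which makes them summable.\<close>
  have h_le: "h k \<le> \<bar>(f - g) \<bullet> \<Phi> k\<bar>\<^sup>2" for k
    unfolding h_def measurements_def by (simp add: inner_diff_left abs_le_square_iff[symmetric])
  have hInr: "h (Inr (j, n)) = (\<bar>\<alpha> n * (f \<bullet> \<phi> j) + r * (f \<bullet> e n)\<bar> - \<bar>\<alpha> n * (g \<bullet> \<phi> j) + r * (g \<bullet> e n)\<bar>)\<^sup>2"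
    for j n
    by (simp add: h_def measurements_def \<Phi> inner_combined_family r_def)
  define m where "m j = infsum (\<lambda>n. h (Inr (j, n))) {2..}" for j
  have hsum: "h summable_on (I <+> (J \<times> {2..}))"
    by (rule summable_on_comparison_test[OF summ]) (use h_le in \<open>auto simp: h_def\<close>)
  have hs: "((\<lambda>n. h (Inr (j, n))) has_sum m j) {2..}" if "j \<in> J" for j
  proof -
    have "h summable_on ((\<lambda>n. Inr (j, n)) ` {2..})"
      by (rule summable_on_subset_banach[OF hsum]) (use that in auto)
    then have "(\<lambda>n. h (Inr (j, n))) summable_on {2..}"
      by (subst (asm) summable_on_reindex) (auto simp: inj_on_def o_def)
    then show ?thesis by (simp add: m_def)
  qed
  have hI: "((\<lambda>i. h (Inl i)) has_sum S) I"
    using \<psi> by (simp add: h_def measurements_def \<Phi> inner_combined_family)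
  have total: "(h has_sum (S + sum m J)) (I <+> (J \<times> {2..}))"
    by (rule has_sum_Plus_Times[OF hI J(1) hs])
  \<comment> \<open>The series are compared at each \<open>n\<close> separately: with the sum over
    \<open>J\<close> moved inside, the cardinality of \<open>L\<close> can be used.\<close>
  have "(1 - t) / C * W + (- (1 / t - 1) * Q) * s \<le> sum m J"
  proof (rule has_sum_mono)
    show "((\<lambda>n. \<Sum>j\<in>J. h (Inr (j, n))) has_sum sum m J) {2..}"
      by (rule has_sum_finite_swap[OF J(1) hs])
    show "((\<lambda>n. (1 - t) / C * ((f - g) \<bullet> e n)\<^sup>2 + (- (1 / t - 1) * Q) * (\<alpha> n)\<^sup>2) has_sum
        ((1 - t) / C * W + (- (1 / t - 1) * Q) * s)) {2..}"
      by (intro has_sum_add has_sum_cmult_right \<alpha> e)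
    fix n :: nat assume "n \<in> {2..}"
    then have n: "n \<ge> 2" by simp
    let ?d = "((f - g) \<bullet> e n)\<^sup>2"
    have gap: "(1 - t) * (r\<^sup>2 * ?d) - (1 / t - 1) * ((\<alpha> n)\<^sup>2 * \<bar>(f - g) \<bullet> \<phi> j\<bar>\<^sup>2) \<le> h (Inr (j, n))"
      if j: "j \<in> L" for j
    proof -
      \<comment> \<open>The weight satisfies \<open>r \<le> 1\<close>, so the unweighted bound
        \<open>high\<close> on the coefficients suffices.\<close>
      have scale: "r * y \<le> y" if "0 \<le> y" for y
        using mult_right_mono[OF r(3) that] by simp
      have "r * \<bar>f \<bullet> e n + g \<bullet> e n\<bar> \<le> \<alpha> n * (c * X) / 2" "r * \<bar>f \<bullet> e n - g \<bullet> e n\<bar> \<le> \<alpha> n * (c * X) / 2"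
        using high[OF n] scale[of "\<bar>f \<bullet> e n + g \<bullet> e n\<bar>"] scale[of "\<bar>f \<bullet> e n - g \<bullet> e n\<bar>"] by linarith+
      moreover have "\<alpha> n * (c * X) \<le> \<alpha> n * \<bar>f \<bullet> \<phi> j + g \<bullet> \<phi> j\<bar>"
        using low[OF j] \<alpha>0[OF n] by (intro mult_left_mono) (simp_all add: inner_add_left)
      ultimately show ?thesis
        using modulus_gap_lower[OF t _ \<alpha>0[OF n] r(2)] by (simp add: hInr inner_diff_left)
    qed
    have "finite L" using J L by (auto intro: finite_subset)
    have "(1 - t) / C * ?d \<le> (1 - t) * ?d * (real (card L) / real (card J))"
    proof -
      have "1 / C \<le> real (card L) / real (card J)" using L cJ C by (simp add: field_simps)
      then have "(1 - t) * ?d * (1 / C) \<le> (1 - t) * ?d * (real (card L) / real (card J))"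
        using t by (intro mult_left_mono) auto
      then show ?thesis by simp
    qed
    also have "\<dots> = (\<Sum>j\<in>L. (1 - t) * (r\<^sup>2 * ?d))" by (simp add: r)
    also have "\<dots> \<le> (\<Sum>j\<in>L. h (Inr (j, n)) + (1 / t - 1) * ((\<alpha> n)\<^sup>2 * \<bar>(f - g) \<bullet> \<phi> j\<bar>\<^sup>2))"
      by (rule sum_mono) (use gap in force)
    \<comment> \<open>With the perturbation moved to this side, every summand is nonnegative because
      \<open>t \<le> 1\<close>, so \<open>L\<close> may be enlarged to \<open>J\<close>.\<close>
    also have "\<dots> \<le> (\<Sum>j\<in>J. h (Inr (j, n)) + (1 / t - 1) * ((\<alpha> n)\<^sup>2 * \<bar>(f - g) \<bullet> \<phi> j\<bar>\<^sup>2))"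
      by (rule sum_mono2) (use J L t in \<open>auto simp: h_def\<close>)
    also have "\<dots> = (\<Sum>j\<in>J. h (Inr (j, n))) + (1 / t - 1) * Q * (\<alpha> n)\<^sup>2"
      by (simp add: sum.distrib Q_def sum_distrib_left sum_distrib_right mult_ac)
    finally show "(1 - t) / C * ?d + (- (1 / t - 1) * Q) * (\<alpha> n)\<^sup>2 \<le> (\<Sum>j\<in>J. h (Inr (j, n)))"
      by (simp add: algebra_simps)
  qed
  moreover have "(l2_norm (I <+> (J \<times> {2..})) (\<lambda>k. measurements \<Phi> f k - measurements \<Phi> g k))\<^sup>2 = S + sum m J"
  proof -
    have "infsum h (I <+> (J \<times> {2..})) = S + sum m J" using total by (rule infsumI)
    moreover have "infsum h (I <+> (J \<times> {2..})) \<ge> 0" by (rule infsum_nonneg) (simp add: h_def)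
    ultimately show ?thesis by (simp add: l2_norm_def h_def [abs_def])
  qed
  ultimately show ?thesis by (simp add: Q_def mult_ac del: minus_diff_eq)
qed

section \<open>Coefficients of vectors in the decay set\<close>

lemma projection_decay_coefficients:
  fixes V :: "'a::real_inner set"
  assumes V: "subspace V" and v: "v \<in> V" "f - v \<in> orthogonal_comp V"
    and on: "\<And>m n. m \<ge> 2 \<Longrightarrow> n \<ge> 2 \<Longrightarrow> e m \<bullet> e n = (if m = n then 1 else 0)"
    and eV: "\<And>n. n \<ge> 2 \<Longrightarrow> e n \<in> orthogonal_comp V"
    and f: "f \<in> projection_decay_set V e \<beta>"
  shows "norm (f - v) \<le> \<beta> 2 * norm f" and "n \<ge> 2 \<Longrightarrow> \<bar>f \<bullet> e n\<bar> \<le> \<beta> n * norm f"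
proof -
  \<comment> \<open>Explicit candidate for the projection onto \<open>extended_space V e m\<close>;
    \<open>f\<close> may replace \<open>f - v\<close> in the coefficients because each
    \<open>e n\<close> is orthogonal to \<open>V\<close>.\<close>
  define p where "p m = v + (\<Sum>n\<in>{2..m}. (f \<bullet> e n) *\<^sub>R e n)" for m
  have oV: "y \<bullet> x = 0" if "y \<in> V" "x \<in> orthogonal_comp V" for x y
    using that by (auto simp: orthogonal_comp_def orthogonal_def)
  have ort: "e n \<bullet> (f - p m) = (if n \<le> m then 0 else f \<bullet> e n)" if n: "n \<ge> 2" for n m
  proof -
    have "(\<Sum>k\<in>{2..m}. (f \<bullet> e k) * (e n \<bullet> e k)) = (\<Sum>k\<in>{2..m}. if k = n then f \<bullet> e n else 0)"
      using on n by (intro sum.cong) auto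
    moreover have "e n \<bullet> v = 0" using oV[OF v(1) eV[OF n]] by (simp add: inner_commute)
    ultimately show ?thesis
      using n by (simp add: p_def inner_diff_right inner_add_right inner_sum_right inner_commute)
  qed
  have proj: "orth_proj (extended_space V e m) f = p m" for m
  proof (rule orth_proj_eq)
    show "subspace (extended_space V e m)"
      unfolding extended_space_def using subspace_sums[OF V subspace_span] .
    show "p m \<in> extended_space V e m"
    proof -
      have "(\<Sum>n\<in>{2..m}. (f \<bullet> e n) *\<^sub>R e n) \<in> span (e ` {2..m})"
        by (intro span_sum span_scale span_base imageI)
      then show ?thesis using v(1) unfolding extended_space_def p_def by blast
    qed
    have "y \<bullet> (f - p m) = 0" if "y \<in> V" for y
    proof -
      have "y \<bullet> (f - v) = 0" using oV that v(2) by blast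
      moreover have "y \<bullet> e k = 0" if "k \<in> {2..m}" for k
        using oV[OF \<open>y \<in> V\<close> eV] that by simp
      ultimately show ?thesis
        by (simp add: p_def inner_diff_right inner_add_right inner_sum_right)
    qed
    moreover have "z \<bullet> (f - p m) = 0" if "z \<in> span (e ` {2..m})" for z
      using that by (induction rule: span_induct_alt) (auto simp: inner_left_distrib ort)
    ultimately show "f - p m \<in> orthogonal_comp (extended_space V e m)"
      by (auto simp: orthogonal_comp_def orthogonal_def extended_space_def inner_left_distrib)
  qed
  have decay: "norm (f - p m) \<le> \<beta> (m + 1) * norm f" if "m \<ge> 1" for m
    using f that by (simp add: projection_decay_set_def proj)
  \<comment> \<open>For \<open>m = 1\<close> the range \<open>{2..m}\<close> is empty, so
    \<open>p 1 = v\<close>.\<close>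
  show "norm (f - v) \<le> \<beta> 2 * norm f"
    using decay[of 1] by (simp add: p_def numeral_2_eq_2)
  \<comment> \<open>Use \<open>m = n - 1\<close>: the coefficient at \<open>e n\<close> is the first
    one not removed by the projection, so Cauchy-Schwarz bounds it by the remainder, and the decay
    condition at \<open>n - 1\<close> carries exactly \<open>\<beta> n\<close>.\<close>
  show "\<bar>f \<bullet> e n\<bar> \<le> \<beta> n * norm f" if n: "n \<ge> 2"
  proof -
    have "norm (e n) = 1" using on[OF n n] by (simp add: norm_eq_sqrt_inner)
    then have "\<bar>e n \<bullet> (f - p (n - 1))\<bar> \<le> norm (f - p (n - 1))"
      using Cauchy_Schwarz_ineq2[of "e n" "f - p (n - 1)"] by simp
    also have "\<dots> \<le> \<beta> n * norm f" using decay[of "n - 1"] n by simp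
    finally show ?thesis using ort[OF n, of "n - 1"] n by (simp split: if_splits)
  qed
qed

text \<open>The explicit lower bound vanishes at \<epsilon> = A, so it is claimed only for
  \<epsilon> < A, while the first conjunct gives a positive lower bound in every case. Stability
  assumes \<open>V1 \<noteq> {0}\<close>: in the zero space the condition on \<open>c\<close> is
  vacuous and does not force \<open>c \<le> 1\<close>, on which the estimates of \<beta>
  rest.\<close>

theorem theorem4p1:
  fixes V1 :: "'a::{real_inner, complete_space, second_countable_topology} set"
    and e :: "nat \<Rightarrow> 'a"
    and I :: "'i set" and \<psi> :: "'i \<Rightarrow> 'a"
    and J :: "'j set" and \<phi> :: "'j \<Rightarrow> 'a"
    and A B C c \<epsilon> :: real
    and \<alpha> \<beta> :: "nat \<Rightarrow> real"
  assumes "\<not> finite_dimensional (UNIV :: 'a set)"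
    and "finite_dimensional V1"
    and "orthonormal_basis {2..} e (orthogonal_comp V1)"
    and "A \<le> B" and "B \<le> 1"
    and "frame_with_bounds V1 I \<psi> A B"
    and "stable_phase_retrieval C V1 I \<psi>"
    and "finite J"
    and "frame_with_bounds V1 J \<phi> A B"
    and "c > 0"
    and "\<forall>x\<in>V1. real (card {j\<in>J. \<bar>x \<bullet> \<phi> j\<bar> \<ge> c * norm x}) \<ge> (1 / C) * real (card J)"
    and "0 < \<epsilon>" and "\<epsilon> < 1 / 8"
    and "antimono_on {2..} \<alpha>" and "\<alpha> \<longlonglongrightarrow> 0"
    and "\<alpha> summable_on {2..}"
    and "(\<Sum>\<^sub>\<infinity>n\<in>{2..}. \<alpha> n) < 1 / 2^2 * (1 / C) * (1 / sqrt (real (card J))) * \<epsilon>"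
    and "antimono_on {2..} \<beta>" and "\<beta> \<longlonglongrightarrow> 0"
    and "\<forall>n\<ge>2. \<beta> n < 1 / 2^6 * c\<^sup>2 * \<alpha> n"
  defines "K \<equiv> I <+> (J \<times> {2..})"
    and "\<Phi> \<equiv> combined_family \<psi> J \<phi> e \<alpha>"
  shows "(\<exists>A'. frame_with_bounds UNIV K \<Phi> A' ((1 + sqrt \<epsilon>)\<^sup>2))
    \<and> (\<epsilon> < A \<longrightarrow> frame_with_bounds UNIV K \<Phi> ((1 - sqrt (\<epsilon> / A))\<^sup>2 * A) ((1 + sqrt \<epsilon>)\<^sup>2))
    \<and> (V1 \<noteq> {0} \<longrightarrow> (\<forall>f \<in> projection_decay_set V1 e \<beta>. \<forall>g \<in> projection_decay_set V1 e \<beta>.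
         (INF \<sigma>\<in>{\<sigma>::real. \<bar>\<sigma>\<bar> = 1}. (norm (f - \<sigma> *\<^sub>R g))\<^sup>2)
           \<le> 1 / (1 - \<epsilon>) * C\<^sup>2 * (l2_norm K (\<lambda>k. measurements \<Phi> f k - measurements \<Phi> g k))\<^sup>2))"
proof -

  \<comment> \<open>Consequences of the hypotheses on \<open>V1\<close> and the two frames\<close>
  have on: "e m \<bullet> e n = (if m = n then 1 else 0)" if "m \<ge> 2" "n \<ge> 2" for m n
    using assms(3) that unfolding orthonormal_basis_def by auto
  have clos: "closure (span (e ` {2..})) = orthogonal_comp V1"
    using assms(3) unfolding orthonormal_basis_def by simp
  have eV: "e n \<in> orthogonal_comp V1" if "n \<ge> 2" for n
    using that by (auto simp: clos[symmetric] intro!: subsetD[OF closure_subset] span_base)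
  have V1: "subspace V1"
    using assms(2) unfolding finite_dimensional_def by auto
  have ort: "f \<bullet> x = v \<bullet> x" if "x \<in> V1" "f - v \<in> orthogonal_comp V1" for f v x
    using that by (auto simp: orthogonal_comp_def orthogonal_def inner_diff_right inner_commute)
  have \<psi>V: "\<psi> i \<in> V1" if "i \<in> I" for i using assms(6) that by (simp add: frame_with_bounds_def)
  have \<phi>V: "\<phi> j \<in> V1" if "j \<in> J" for j using assms(9) that by (simp add: frame_with_bounds_def)
  have A: "0 < A" "A \<le> 1" using assms by (auto simp: frame_with_bounds_def)
  have C: "C \<ge> 1" using assms(7) by (simp add: stable_phase_retrieval_def)
  have \<epsilon>: "0 < \<epsilon>" "\<epsilon> < 1 / 8" by fact+
  have \<phi>le: "(\<Sum>j\<in>J. \<bar>v \<bullet> \<phi> j\<bar>\<^sup>2) \<le> (norm v)\<^sup>2" if "v \<in> V1" for v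
  proof -
    have "(\<Sum>j\<in>J. \<bar>v \<bullet> \<phi> j\<bar>\<^sup>2) \<le> B * (norm v)\<^sup>2"
      using assms(8,9) that by (simp add: frame_with_bounds_def)
    also have "\<dots> \<le> (norm v)\<^sup>2" using \<open>B \<le> 1\<close> mult_right_mono[of B 1 "(norm v)\<^sup>2"] by simp
    finally show ?thesis .
  qed

  \<comment> \<open>Size of the perturbation \<alpha>\<close>
  have \<alpha>0: "0 \<le> \<alpha> n" if "n \<ge> 2" for n
  proof (rule tendsto_upperbound[OF assms(15)])
    show "\<forall>\<^sub>F k in sequentially. \<alpha> k \<le> \<alpha> n"
      using eventually_ge_at_top[of n]
      by eventually_elim (use monotone_onD[OF assms(14)] that in auto)
  qed simp
  define T where "T = infsum \<alpha> {2..}"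
  have \<alpha>T: "\<alpha> n \<le> T" if "n \<ge> 2" for n
    using finite_sum_le_infsum[OF assms(16), of "{n}"] \<alpha>0 that by (simp add: T_def)
  have T0: "0 \<le> T" unfolding T_def by (rule infsum_nonneg) (simp add: \<alpha>0)
  \<comment> \<open>For empty \<open>J\<close> the factor \<open>1 / sqrt 0\<close> is 0 by
    convention, and the bound on the sum of \<alpha> would read \<open>T < 0\<close>.\<close>
  have J: "finite J" "J \<noteq> {}"
    using assms(8,17) T0 by (auto simp: T_def)
  have cJ: "sqrt (real (card J)) \<ge> 1" using J by (simp add: Suc_leI card_gt_0_iff)
  have T1: "T \<le> \<epsilon> / (4 * C)"
  proof -
    have "T \<le> \<epsilon> / (4 * C) * (1 / sqrt (real (card J)))" using assms(17) by (simp add: T_def)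
    also have "\<dots> \<le> \<epsilon> / (4 * C) * 1" by (rule mult_left_mono) (use cJ C \<epsilon> in auto)
    finally show ?thesis by simp
  qed
  \<comment> \<open>Each \<open>\<alpha> n\<close> is at most the whole sum \<open>T\<close>, so
    \<open>s \<le> T * T\<close>. The resulting order \<open>\<epsilon>\<^sup>2 / C\<^sup>2\<close>
    matters for stability, where \<open>s\<close> gets multiplied by \<open>C\<^sup>2\<close> and
    divided by \<epsilon>.\<close>
  define s where "s = infsum (\<lambda>n. (\<alpha> n)\<^sup>2) {2..}"
  have sq: "(\<alpha> n)\<^sup>2 \<le> T * \<alpha> n" if "n \<ge> 2" for n
    using \<alpha>T[OF that] \<alpha>0[OF that] by (simp add: power2_eq_square mult_right_mono)
  have Th: "((\<lambda>n. T * \<alpha> n) has_sum (T * T)) {2..}"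
    by (rule has_sum_cmult_right) (simp add: T_def assms(16))
  have "(\<lambda>n. (\<alpha> n)\<^sup>2) summable_on {2..}"
    by (rule summable_on_comparison_test[OF has_sum_imp_summable[OF Th]]) (use sq in auto)
  then have sh: "((\<lambda>n. (\<alpha> n)\<^sup>2) has_sum s) {2..}" by (simp add: s_def)
  have s0: "0 \<le> s" unfolding s_def by (rule infsum_nonneg) simp
  have "s \<le> T * T" by (rule has_sum_mono[OF sh Th]) (use sq in auto)
  also have "\<dots> \<le> (\<epsilon> / (4 * C)) * (\<epsilon> / (4 * C))" using T0 T1 by (intro mult_mono) auto
  finally have "s \<le> \<epsilon>\<^sup>2 / (16 * C\<^sup>2)" by (simp add: power2_eq_square mult_ac)
  then have sC: "C\<^sup>2 * s \<le> \<epsilon>\<^sup>2 / 16" using C by (simp add: field_simps)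
  have "s \<le> C\<^sup>2 * s" using C s0 mult_right_mono[of 1 "C\<^sup>2" s] by simp
  also have "\<dots> \<le> \<epsilon>" using sC \<epsilon> mult_right_mono[of \<epsilon> 1 \<epsilon>] unfolding power2_eq_square by linarith
  finally have s\<epsilon>: "s \<le> \<epsilon>" .

  \<comment> \<open>Frame bounds\<close>
  have pars: "((\<lambda>n. (f \<bullet> e n)\<^sup>2) has_sum (norm (f - v))\<^sup>2) {2..}"
    if "v \<in> V1" "f - v \<in> orthogonal_comp V1" for f v
  proof -
    have "((\<lambda>n. ((f - v) \<bullet> e n)\<^sup>2) has_sum (norm (f - v))\<^sup>2) {2..}"
      by (rule Parseval_has_sum) (use on that clos in auto)
    moreover have "(f - v) \<bullet> e n = f \<bullet> e n" if "n \<ge> 2" for n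
      using eV[OF that] \<open>v \<in> V1\<close> by (simp add: orthogonal_comp_def orthogonal_def inner_diff_left)
    ultimately show ?thesis
      using has_sum_cong[of "{2..}" "\<lambda>n. ((f - v) \<bullet> e n)\<^sup>2" "\<lambda>n. (f \<bullet> e n)\<^sup>2"] by simp
  qed
  have pyth: "(norm f)\<^sup>2 = (norm v)\<^sup>2 + (norm (f - v))\<^sup>2"
    if "v \<in> V1" "f - v \<in> orthogonal_comp V1" for f v
    using that norm_add_Pythagorean[of v "f - v"] by (simp add: orthogonal_comp_def)
  \<comment> \<open>With \<open>V\<close> and \<open>W\<close> the squared norms of the components
    of \<open>f\<close>, and \<open>S\<close> and \<open>M\<close> the totals over the two families,
    the frame bounds become inequalities between real numbers. The lower estimate is restricted to
    \<open>t \<le> 1\<close> so that \<open>1 / t - 1\<close> is nonnegative when \<open>Q\<close>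
    is replaced by \<open>V\<close>.\<close>
  have key: "\<exists>V W S M. 0 \<le> V \<and> 0 \<le> W \<and> (norm f)\<^sup>2 = V + W \<and> A * V \<le> S \<and> S \<le> V
      \<and> ((\<lambda>k. \<bar>f \<bullet> \<Phi> k\<bar>\<^sup>2) has_sum (S + M)) K
      \<and> (\<forall>t>0. M \<le> (1 + t) * W + (1 + 1 / t) * (s * V))
      \<and> (\<forall>t>0. t \<le> 1 \<longrightarrow> (1 - t) * W - (1 / t - 1) * (s * V) \<le> M)" for f
  proof -
    obtain v where v: "v \<in> V1" "f - v \<in> orthogonal_comp V1"
      using orth_decomposition_exists[OF assms(2)] by blast
    define S where "S = infsum (\<lambda>i. \<bar>v \<bullet> \<psi> i\<bar>\<^sup>2) I"
    have S: "((\<lambda>i. \<bar>v \<bullet> \<psi> i\<bar>\<^sup>2) has_sum S) I" "A * (norm v)\<^sup>2 \<le> S" "S \<le> B * (norm v)\<^sup>2"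
      using assms(6) v(1) by (auto simp: frame_with_bounds_def S_def)
    have S1: "((\<lambda>i. \<bar>f \<bullet> \<psi> i\<bar>\<^sup>2) has_sum S) I"
      using S(1) ort[OF \<psi>V v(2)] by (simp cong: has_sum_cong)
    have SB: "S \<le> (norm v)\<^sup>2"
      using S(3) \<open>B \<le> 1\<close> mult_right_mono[of B 1 "(norm v)\<^sup>2"] by simp
    define Q where "Q = (\<Sum>j\<in>J. \<bar>f \<bullet> \<phi> j\<bar>\<^sup>2)"
    have Q: "s * Q \<le> s * (norm v)\<^sup>2"
      using \<phi>le[OF v(1)] ort[OF \<phi>V v(2)] s0 by (simp add: Q_def mult_left_mono)
    obtain M where M: "((\<lambda>k. \<bar>f \<bullet> \<Phi> k\<bar>\<^sup>2) has_sum (S + M)) K"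
      "\<And>t. t > 0 \<Longrightarrow> M \<le> (1 + t) * (norm (f - v))\<^sup>2 + (1 + 1 / t) * (s * Q)"
      "\<And>t. t > 0 \<Longrightarrow> (1 - t) * (norm (f - v))\<^sup>2 - (1 / t - 1) * (s * Q) \<le> M"
      using combined_family_has_sum[OF J S1 sh pars[OF v]] unfolding \<Phi>_def K_def Q_def by blast
    have "M \<le> (1 + t) * (norm (f - v))\<^sup>2 + (1 + 1 / t) * (s * (norm v)\<^sup>2)" if "t > 0" for t
      using M(2)[OF that] mult_left_mono[OF Q, of "1 + 1 / t"] that by simp
    moreover have "(1 - t) * (norm (f - v))\<^sup>2 - (1 / t - 1) * (s * (norm v)\<^sup>2) \<le> M"
      if "t > 0" "t \<le> 1" for t
      using M(3)[OF that(1)] mult_left_mono[OF Q, of "1 / t - 1"] that by simp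
    ultimately show ?thesis
      using pyth[OF v] S(2) SB M(1)
      by (intro exI[of _ "(norm v)\<^sup>2"] exI[of _ "(norm (f - v))\<^sup>2"] exI[of _ S] exI[of _ M]) auto
  qed
  have upper: "S + M \<le> (1 + sqrt \<epsilon>)\<^sup>2 * (V + W)"
    if "0 \<le> V" "0 \<le> W" "S \<le> V" and M: "\<forall>t>0. M \<le> (1 + t) * W + (1 + 1 / t) * (s * V)"
    for V W S M
  proof -
    \<comment> \<open>Since \<open>s \<le> \<epsilon> = q * q\<close>, weight \<open>q\<close> makes
      the perturbation cost \<open>(q * q + q) * V\<close>, which fits under
      \<open>(1 + q)\<^sup>2 * (V + W)\<close>.\<close>
    define q where "q = sqrt \<epsilon>"
    have q: "q > 0" "q * q = \<epsilon>" using \<epsilon> by (auto simp: q_def)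
    have "(1 + 1 / q) * (s * V) \<le> (1 + 1 / q) * (q * q * V)"
      using s\<epsilon> q that(1) by (intro mult_left_mono mult_right_mono) auto
    also have "\<dots> = (q * q + q) * V" using q by (simp add: field_simps)
    finally have "S + M \<le> V + (1 + q) * W + (q * q + q) * V" using M q(1) that(3) by force
    also have "\<dots> \<le> (1 + q)\<^sup>2 * (V + W)"
    proof -
      have "(1 + q)\<^sup>2 * (V + W) - (V + (1 + q) * W + (q * q + q) * V) = q * V + (q + q * q) * W"
        by (simp add: power2_eq_square algebra_simps)
      moreover have "\<dots> \<ge> 0" using q(1) that by simp
      ultimately show ?thesis by linarith
    qed
    finally show ?thesis by (simp add: q_def)
  qed
  have frameI: "frame_with_bounds UNIV K \<Phi> A' ((1 + sqrt \<epsilon>)\<^sup>2)"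
    if "0 < A'" and low: "\<And>V W M. 0 \<le> V \<Longrightarrow> 0 \<le> W
      \<Longrightarrow> \<forall>t>0. t \<le> 1 \<longrightarrow> (1 - t) * W - (1 / t - 1) * (s * V) \<le> M \<Longrightarrow> A' * (V + W) \<le> A * V + M" for A'
    unfolding frame_with_bounds_def
  proof (intro conjI ballI)
    fix f :: 'a
    obtain V W S M where P: "0 \<le> V" "0 \<le> W" "(norm f)\<^sup>2 = V + W" "A * V \<le> S" "S \<le> V"
      "((\<lambda>k. \<bar>f \<bullet> \<Phi> k\<bar>\<^sup>2) has_sum (S + M)) K"
      "\<forall>t>0. M \<le> (1 + t) * W + (1 + 1 / t) * (s * V)"
      "\<forall>t>0. t \<le> 1 \<longrightarrow> (1 - t) * W - (1 / t - 1) * (s * V) \<le> M"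
      using key[of f] by blast
    show "(\<lambda>k. \<bar>f \<bullet> \<Phi> k\<bar>\<^sup>2) summable_on K" by (rule has_sum_imp_summable[OF P(6)])
    show "A' * (norm f)\<^sup>2 \<le> (\<Sum>\<^sub>\<infinity>k\<in>K. \<bar>f \<bullet> \<Phi> k\<bar>\<^sup>2)"
      using low[OF P(1,2,8)] P(4) unfolding infsumI[OF P(6)] P(3) by linarith
    show "(\<Sum>\<^sub>\<infinity>k\<in>K. \<bar>f \<bullet> \<Phi> k\<bar>\<^sup>2) \<le> (1 + sqrt \<epsilon>)\<^sup>2 * (norm f)\<^sup>2"
      using upper[OF P(1,2,5,7)] unfolding infsumI[OF P(6)] P(3) .
  qed (use that in auto)
  \<comment> \<open>The weight \<open>t = 2 / (2 + A)\<close> lets the perturbation cost at most half of the lower bound \<open>A\<close>,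
    so that a lower frame bound survives even if \<open>\<epsilon> \<ge> A\<close>.\<close>
  have frame: "frame_with_bounds UNIV K \<Phi> (A / (2 + A)) ((1 + sqrt \<epsilon>)\<^sup>2)"
  proof (rule frameI)
    fix V W M :: real
    assume VW: "0 \<le> V" "0 \<le> W" and M: "\<forall>t>0. t \<le> 1 \<longrightarrow> (1 - t) * W - (1 / t - 1) * (s * V) \<le> M"
    let ?t = "2 / (2 + A)"
    define \<kappa> where "\<kappa> = A / (2 + A)"
    have t: "?t > 0" "?t \<le> 1" "1 - ?t = \<kappa>" "1 / ?t - 1 = A / 2"
      using A by (auto simp: \<kappa>_def field_simps)
    have "\<kappa> * W - A / 2 * (s * V) \<le> M"
      using M t by metis
    moreover have "A / 2 * (s * V) \<le> A / 2 * (1 * V)"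
      using s\<epsilon> \<epsilon> A VW by (intro mult_left_mono mult_right_mono) auto
    moreover have "\<kappa> * V \<le> A / 2 * V"
      using A VW by (intro mult_right_mono) (auto simp: \<kappa>_def field_simps)
    ultimately have "\<kappa> * (V + W) \<le> A * V + M" by (simp add: algebra_simps)
    then show "A / (2 + A) * (V + W) \<le> A * V + M" by (simp only: \<kappa>_def)
  qed (use A in auto)
  have sharp: "frame_with_bounds UNIV K \<Phi> ((1 - sqrt (\<epsilon> / A))\<^sup>2 * A) ((1 + sqrt \<epsilon>)\<^sup>2)" if "\<epsilon> < A"
  proof (rule frameI)
    \<comment> \<open>With this weight and \<open>s \<le> q * q * A\<close> the perturbation costs
      \<open>(q - q * q) * A * V\<close>, leaving \<open>V\<close> a coefficient above
      \<open>(1 - q)\<^sup>2 * A\<close>. The coefficient \<open>1 - q\<close> of \<open>W\<close>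
      is large enough because \<open>A \<le> 1\<close>.\<close>
    define q where "q = sqrt (\<epsilon> / A)"
    have q: "0 < q" "q < 1" "\<epsilon> = q * q * A"
      using \<epsilon> A that by (auto simp: q_def)
    have "0 < (1 - q)\<^sup>2 * A" using q(2) A by simp
    then show "0 < (1 - sqrt (\<epsilon> / A))\<^sup>2 * A" by (simp only: q_def)
    fix V W M :: real
    assume VW: "0 \<le> V" "0 \<le> W" and M: "\<forall>t>0. t \<le> 1 \<longrightarrow> (1 - t) * W - (1 / t - 1) * (s * V) \<le> M"
    have "(1 / q - 1) * (s * V) \<le> (1 / q - 1) * (q * q * A * V)"
      using s\<epsilon> q VW by (intro mult_left_mono mult_right_mono) auto
    also have "\<dots> = (q - q * q) * A * V" using q(1) by (simp add: field_simps)
    finally have "(1 / q - 1) * (s * V) \<le> (q - q * q) * A * V" .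
    moreover have "(1 - q) * W - (1 / q - 1) * (s * V) \<le> M" using M[rule_format, of q] q by simp
    ultimately have "(1 - q) * W - (q - q * q) * A * V \<le> M" by linarith
    moreover have "(1 - q)\<^sup>2 * A * W \<le> (1 - q) * W"
    proof -
      have "(1 - q) * A \<le> 1 * 1" using q A by (intro mult_mono) auto
      then have "(1 - q) * W * ((1 - q) * A) \<le> (1 - q) * W * 1"
        using q VW by (intro mult_left_mono) auto
      then show ?thesis by (simp add: power2_eq_square mult_ac)
    qed
    moreover have "A * V - (q - q * q) * A * V - (1 - q)\<^sup>2 * A * V = q * A * V"
      by (simp add: power2_eq_square algebra_simps)
    moreover have "0 \<le> q * A * V" using q A VW by simp
    ultimately have "(1 - q)\<^sup>2 * A * (V + W) \<le> A * V + M" by (simp add: distrib_left)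
    then show "(1 - sqrt (\<epsilon> / A))\<^sup>2 * A * (V + W) \<le> A * V + M" by (simp add: q_def)
  qed
  have \<Phi>summ: "(\<lambda>k. \<bar>f \<bullet> \<Phi> k\<bar>\<^sup>2) summable_on K" for f
    using frame by (simp add: frame_with_bounds_def)

  \<comment> \<open>Stability on the decay set, for the favourable sign\<close>
  define D where "D f v \<longleftrightarrow> v \<in> V1 \<and> f - v \<in> orthogonal_comp V1 \<and> norm (f - v) \<le> \<beta> 2 * norm f
    \<and> (\<forall>n\<ge>2. \<bar>f \<bullet> e n\<bar> \<le> \<beta> n * norm f)" for f v
  \<comment> \<open>Decay does not see a global sign, so \<open>g\<close> can later be replaced by
    \<open>- g\<close>.\<close>
  have D_minus: "D (- f) (- v)" if "D f v" for f v
  proof -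
    have "- f - - v = - (f - v)" by simp
    moreover have "- v \<in> V1" "- (f - v) \<in> orthogonal_comp V1"
      using that subspace_neg V1 subspace_orthogonal_comp unfolding D_def by blast+
    ultimately show ?thesis
      using that unfolding D_def by (metis norm_minus_cancel inner_minus_left abs_minus_cancel)
  qed
  \<comment> \<open>Under \<open>vw\<close> the sign of \<open>g\<close> is already the better one
    for the components in \<open>V1\<close>, so \<open>f - g\<close> itself is estimated.\<close>
  have stable: "(norm (f - g))\<^sup>2
      \<le> 1 / (1 - \<epsilon>) * C\<^sup>2 * (l2_norm K (\<lambda>k. measurements \<Phi> f k - measurements \<Phi> g k))\<^sup>2"
    if ne: "V1 \<noteq> {0}" and f: "D f v" and g: "D g w" and vw: "norm (v - w) \<le> norm (v + w)" for f g v w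
  proof -
    have v: "v \<in> V1" "f - v \<in> orthogonal_comp V1" and w: "w \<in> V1" "g - w \<in> orthogonal_comp V1"
      using f g by (auto simp: D_def)
    have d: "v - w \<in> V1" "f - g - (v - w) \<in> orthogonal_comp V1"
      using v w V1 subspace_diff subspace_diff[OF subspace_orthogonal_comp v(2) w(2)]
      by (auto simp: algebra_simps)
    define X where "X = norm (v + w)"
    define L where "L = {j \<in> J. \<bar>(v + w) \<bullet> \<phi> j\<bar> \<ge> c * norm (v + w)}"
    have cardL: "real (card J) \<le> C * real (card L)"
      using assms(11) subspace_add[OF V1 v(1) w(1)] C by (simp add: L_def field_simps)
    \<comment> \<open>For nonzero \<open>x\<close> some \<open>\<phi> j\<close> has inner product at
      least \<open>c * norm x\<close> with \<open>x\<close>, while the upper frame bound is at most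
      1.\<close>
    have c1: "c \<le> 1"
    proof -
      obtain x where x: "x \<in> V1" "x \<noteq> 0" using ne subspace_0[OF V1] by auto
      have "real (card {j\<in>J. \<bar>x \<bullet> \<phi> j\<bar> \<ge> c * norm x}) \<ge> (1 / C) * real (card J)"
        using assms(11) x(1) by blast
      moreover have "(1 / C) * real (card J) > 0" using C J by (simp add: card_gt_0_iff)
      ultimately have "card {j\<in>J. \<bar>x \<bullet> \<phi> j\<bar> \<ge> c * norm x} \<noteq> 0" by linarith
      then obtain j where j: "j \<in> J" "\<bar>x \<bullet> \<phi> j\<bar> \<ge> c * norm x" unfolding card_eq_0_iff by blast
      have "(c * norm x)\<^sup>2 \<le> \<bar>x \<bullet> \<phi> j\<bar>\<^sup>2" using j \<open>c > 0\<close> by (intro power_mono) auto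
      also have "\<dots> \<le> (\<Sum>j\<in>J. \<bar>x \<bullet> \<phi> j\<bar>\<^sup>2)" using j J by (intro member_le_sum) auto
      also have "\<dots> \<le> (norm x)\<^sup>2" by (rule \<phi>le[OF x(1)])
      finally have "c * norm x \<le> norm x" by (rule power2_le_imp_le) simp
      then show ?thesis using x(2) by simp
    qed
    have \<beta>: "\<beta> n \<le> c * \<alpha> n / 64" if "n \<ge> 2" for n
    proof -
      have "\<beta> n \<le> c * (c * \<alpha> n) / 64" using assms(20) that by (force simp: power2_eq_square)
      also have "\<dots> \<le> 1 * (c * \<alpha> n) / 64"
        using c1 \<alpha>0[OF that] \<open>c > 0\<close> by (intro divide_right_mono mult_right_mono) auto
      finally show ?thesis by simp
    qed
    have "c * \<alpha> 2 \<le> 1 * 1"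
    proof (rule mult_mono)
      have "\<epsilon> / (4 * C) \<le> 1" using \<epsilon> C by (simp add: field_simps)
      then show "\<alpha> 2 \<le> 1" using \<alpha>T[of 2] T1 by simp
    qed (use c1 \<alpha>0 in auto)
    then have \<beta>2: "\<beta> 2 \<le> 1 / 2" using \<beta>[of 2] by simp
    \<comment> \<open>The remainder outside \<open>V1\<close> has at most half the norm of
      \<open>h\<close>, so it can be absorbed on the left.\<close>
    have half: "norm h \<le> 2 * norm u" if "D h u" for h u
    proof -
      have "norm h \<le> norm u + norm (h - u)" by (rule norm_triangle_sub)
      moreover have "norm (h - u) \<le> 1 / 2 * norm h"
        using that \<beta>2 mult_right_mono[OF \<beta>2, of "norm h"] by (simp add: D_def)
      ultimately show ?thesis by simp
    qed
    \<comment> \<open>The comparison of norms says \<open>v \<bullet> w \<ge> 0\<close>, hence both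
      components, and then \<open>f\<close> and \<open>g\<close>, are controlled by
      \<open>X = norm (v + w)\<close>.\<close>
    have "(norm (v - w))\<^sup>2 \<le> (norm (v + w))\<^sup>2" using vw by (intro power_mono) auto
    then have "v \<bullet> w \<ge> 0"
      by (simp add: power2_norm_eq_inner inner_diff_left inner_diff_right inner_add_left inner_add_right inner_commute)
    then have "(norm v)\<^sup>2 \<le> X\<^sup>2" "(norm w)\<^sup>2 \<le> X\<^sup>2"
      by (simp_all add: X_def power2_norm_eq_inner inner_add_left inner_add_right inner_commute)
    then have "norm v \<le> X" "norm w \<le> X" by (auto intro: power2_le_imp_le simp: X_def)
    then have fX: "norm f \<le> 2 * X" "norm g \<le> 2 * X" using half f g by fastforce+
    have high: "\<bar>f \<bullet> e n\<bar> + \<bar>g \<bullet> e n\<bar> \<le> \<alpha> n * (c * X) / 2" if n: "n \<ge> 2" for n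
    proof -
      have "\<bar>f \<bullet> e n\<bar> + \<bar>g \<bullet> e n\<bar> \<le> \<beta> n * (norm f + norm g)"
        using f g n unfolding D_def distrib_left by (intro add_mono) auto
      also have "\<dots> \<le> c * \<alpha> n / 64 * (4 * X)"
        using \<beta>[OF n] fX \<alpha>0[OF n] \<open>c > 0\<close> by (intro mult_mono) auto
      also have "\<dots> = \<alpha> n * (c * X) / 16" by simp
      also have "\<dots> \<le> \<alpha> n * (c * X) / 2"
        using \<alpha>0[OF n] \<open>c > 0\<close> by (intro divide_left_mono) (auto simp: X_def)
      finally show ?thesis .
    qed
    have "(\<lambda>i. \<bar>(v - w) \<bullet> \<psi> i\<bar>\<^sup>2) summable_on I"
      using assms(6) d(1) by (simp add: frame_with_bounds_def)
    then have \<psi>summ: "(\<lambda>i. (measurements \<psi> v i - measurements \<psi> w i)\<^sup>2) summable_on I"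
      by (rule summable_on_comparison_test)
        (simp_all add: measurements_def inner_diff_left abs_le_square_iff[symmetric])
    define S where "S = infsum (\<lambda>i. (measurements \<psi> v i - measurements \<psi> w i)\<^sup>2) I"
    have "S \<ge> 0" unfolding S_def by (rule infsum_nonneg) simp
    have meas: "measurements \<psi> f i = measurements \<psi> v i" "measurements \<psi> g i = measurements \<psi> w i"
      if "i \<in> I" for i
      using ort[OF \<psi>V[OF that]] v(2) w(2) by (simp_all add: measurements_def)
    have S: "((\<lambda>i. (measurements \<psi> f i - measurements \<psi> g i)\<^sup>2) has_sum S) I"
      using has_sum_infsum[OF \<psi>summ] unfolding S_def[symmetric] by (simp add: meas cong: has_sum_cong)
    \<comment> \<open>By \<open>vw\<close> the sign 1 is optimal, so phase retrieval in
      \<open>V1\<close> bounds \<open>norm (v - w)\<close> itself.\<close>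
    have "norm (v - w) \<le> (INF \<sigma>\<in>{\<sigma>::real. \<bar>\<sigma>\<bar> = 1}. norm (v - \<sigma> *\<^sub>R w))"
    proof (rule cINF_greatest)
      show "{\<sigma>::real. \<bar>\<sigma>\<bar> = 1} \<noteq> {}" by (auto intro: exI[of _ 1])
      fix \<sigma> :: real assume "\<sigma> \<in> {\<sigma>. \<bar>\<sigma>\<bar> = 1}"
      then have "\<sigma> = 1 \<or> \<sigma> = - 1" by auto
      then show "norm (v - w) \<le> norm (v - \<sigma> *\<^sub>R w)" using vw by auto
    qed
    also have "\<dots> \<le> C * sqrt S"
      using assms(7) v(1) w(1) by (simp add: stable_phase_retrieval_def l2_norm_def S_def)
    finally have "(norm (v - w))\<^sup>2 \<le> (C * sqrt S)\<^sup>2" by (intro power_mono) auto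
    then have vS: "(norm (v - w))\<^sup>2 \<le> C\<^sup>2 * S" using \<open>S \<ge> 0\<close> by (simp add: power_mult_distrib)
    define R where "R = (l2_norm K (\<lambda>k. measurements \<Phi> f k - measurements \<Phi> g k))\<^sup>2"
    define W where "W = (norm (f - g - (v - w)))\<^sup>2"
    define Q where "Q = (\<Sum>j\<in>J. \<bar>(f - g) \<bullet> \<phi> j\<bar>\<^sup>2)"
    have Q: "Q \<le> (norm (v - w))\<^sup>2"
      using \<phi>le[OF d(1)] ort[OF \<phi>V d(2)] by (simp add: Q_def)
    have "Q \<ge> 0" by (simp add: Q_def sum_nonneg)
    \<comment> \<open>Weight \<epsilon> produces the factor \<open>1 - \<epsilon>\<close> of the
      claim.\<close>
    have gap: "S + (1 - \<epsilon>) / C * W - (1 / \<epsilon> - 1) * (s * Q) \<le> R"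
      unfolding R_def K_def W_def Q_def
    proof (rule combined_family_gap[where X = X and L = L and c = c and \<alpha> = \<alpha> and \<psi> = \<psi> and e = e])
      show "c * X \<le> \<bar>(f + g) \<bullet> \<phi> j\<bar>" if "j \<in> L" for j
        using that ort[OF \<phi>V v(2)] ort[OF \<phi>V w(2)] by (simp add: L_def X_def inner_add_left)
      show "((\<lambda>n. ((f - g) \<bullet> e n)\<^sup>2) has_sum (norm (f - g - (v - w)))\<^sup>2) {2..}" by (rule pars[OF d])
      show "(\<lambda>k. \<bar>(f - g) \<bullet> \<Phi> k\<bar>\<^sup>2) summable_on (I <+> (J \<times> {2..}))"
        using \<Phi>summ unfolding K_def .
    qed (use J cardL C \<epsilon> \<alpha>0 high sh S in \<open>auto simp: L_def \<Phi>_def\<close>)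
    \<comment> \<open>After multiplication by \<open>C\<^sup>2\<close>, the coefficient of
      \<open>W\<close> is at least \<open>1 - \<epsilon>\<close> because \<open>C \<ge> 1\<close>.
      The perturbation costs at most \<open>\<epsilon> * (norm (v - w))\<^sup>2\<close>, taken from
      \<open>C\<^sup>2 * S\<close>, which dominates \<open>(norm (v - w))\<^sup>2\<close>.\<close>
    have "C\<^sup>2 * (S + (1 - \<epsilon>) / C * W - (1 / \<epsilon> - 1) * (s * Q)) \<le> C\<^sup>2 * R"
      using gap by (intro mult_left_mono) auto
    moreover have "C\<^sup>2 * (S + (1 - \<epsilon>) / C * W - (1 / \<epsilon> - 1) * (s * Q))
        = C\<^sup>2 * S + C * ((1 - \<epsilon>) * W) - (1 / \<epsilon> - 1) * (C\<^sup>2 * s) * Q"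
    proof -
      have "C\<^sup>2 * ((1 - \<epsilon>) / C * W) = C * ((1 - \<epsilon>) * W)"
        using C by (simp add: power2_eq_square)
      then show ?thesis
        unfolding distrib_left right_diff_distrib by (simp add: mult_ac)
    qed
    moreover have "1 * ((1 - \<epsilon>) * W) \<le> C * ((1 - \<epsilon>) * W)"
      using C \<epsilon> by (intro mult_right_mono) (auto simp: W_def)
    moreover have "(1 / \<epsilon> - 1) * (C\<^sup>2 * s) * Q \<le> \<epsilon> * (norm (v - w))\<^sup>2"
    proof -
      have "C\<^sup>2 * s \<le> \<epsilon>\<^sup>2" using sC zero_le_power2[of \<epsilon>] by linarith
      then have "(1 / \<epsilon> - 1) * (C\<^sup>2 * s) \<le> (1 / \<epsilon>) * \<epsilon>\<^sup>2"
        using s0 \<epsilon> by (intro mult_mono) auto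
      also have "\<dots> = \<epsilon>" using \<epsilon> by (simp add: power2_eq_square)
      finally show ?thesis using Q \<open>Q \<ge> 0\<close> \<epsilon> by (intro mult_mono) auto
    qed
    ultimately have "(1 - \<epsilon>) * (norm (v - w))\<^sup>2 + (1 - \<epsilon>) * W \<le> C\<^sup>2 * R"
      using vS by (simp add: algebra_simps)
    moreover have "(norm (f - g))\<^sup>2 = (norm (v - w))\<^sup>2 + W" using pyth[OF d] by (simp add: W_def)
    ultimately have "(1 - \<epsilon>) * (norm (f - g))\<^sup>2 \<le> C\<^sup>2 * R" by (simp add: distrib_left)
    then show ?thesis using \<epsilon> unfolding R_def[symmetric] by (simp add: field_simps)
  qed

  \<comment> \<open>Choice of the sign\<close>
  have "(INF \<sigma>\<in>{\<sigma>::real. \<bar>\<sigma>\<bar> = 1}. (norm (f - \<sigma> *\<^sub>R g))\<^sup>2)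
      \<le> 1 / (1 - \<epsilon>) * C\<^sup>2 * (l2_norm K (\<lambda>k. measurements \<Phi> f k - measurements \<Phi> g k))\<^sup>2"
    if ne: "V1 \<noteq> {0}" and f: "f \<in> projection_decay_set V1 e \<beta>" and g: "g \<in> projection_decay_set V1 e \<beta>"
    for f g
  proof -
    have exD: "\<exists>v. D h v" if "h \<in> projection_decay_set V1 e \<beta>" for h
    proof -
      obtain v where v: "v \<in> V1" "h - v \<in> orthogonal_comp V1"
        using orth_decomposition_exists[OF assms(2)] by blast
      show ?thesis
        using v projection_decay_coefficients[OF V1 v on eV that] unfolding D_def by blast
    qed
    obtain v w where vw: "D f v" "D g w" using exD f g by blast
    have INF_le: "(INF \<sigma>\<in>{\<sigma>::real. \<bar>\<sigma>\<bar> = 1}. (norm (f - \<sigma> *\<^sub>R g))\<^sup>2) \<le> (norm (f - \<sigma> *\<^sub>R g))\<^sup>2"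
      if "\<bar>\<sigma>\<bar> = 1" for \<sigma>
      by (rule cINF_lower) (use that in \<open>auto intro: bdd_belowI2[where m = 0]\<close>)
    show ?thesis
    proof (cases "norm (v - w) \<le> norm (v + w)")
      case True
      then show ?thesis using INF_le[of 1] stable[OF ne vw True] by simp
    next
      case False
      \<comment> \<open>Replace \<open>g\<close> and \<open>w\<close> by their negatives; the
        measurements are unchanged, and the sign \<open>- 1\<close> bounds the infimum.\<close>
      then have "norm (v - - w) \<le> norm (v + - w)" by simp
      from stable[OF ne vw(1) D_minus[OF vw(2)] this] show ?thesis
        using INF_le[of "- 1"] by (simp add: measurements_def)
    qed
  qed
  then show ?thesis using frame sharp by blast
qed

end
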